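(* If a nontrivial finite group $G$ is Rhodes-prime with respect to semidirect products in the category of finite groups, then $G$ is simple.
   Context: A group is nontrivial if it has more than one element. $H$ is a subquotient of a group $G$ if $H$ is isomorphic to a homomorphic image of a subgroup of $G$. A nontrivial finite group $G$ is Rhodes-prime with respect to semidirect products in the category of finite groups if, whenever $G$ is a subquotient of a finite group that can be written as a semidirect product $G_0\rtimes G_1$ (with $G_0$ the normal factor), then $G$ is a subquotient of one of $G_0$ or $G_1$. *)

theory Defs
  imports "HOL-Algebra.SimpleGroups" "HOL-Algebra.Bij"
begin

definition finite_group :: "('a, 'm) monoid_scheme \<Rightarrow> bool" where
  "finite_group G \<longleftrightarrow> group G \<and> finite (carrier G)"

definition nontrivial :: "('a, 'm) monoid_scheme \<Rightarrow> bool" where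
  "nontrivial G \<longleftrightarrow> (\<exists>x\<in>carrier G. \<exists>y\<in>carrier G. x \<noteq> y)"

text \<open>
  The target \<open>K\<close> of the homomorphism whose image is taken is required to have elements of the
  same type as \<open>H\<close>. This loses nothing, as the image is isomorphic to \<open>H\<close>; see
  \<open>subquotientI\<close> for a target over an arbitrary type.
\<close>

definition subquotient :: "('h, 'm) monoid_scheme \<Rightarrow> ('g, 'n) monoid_scheme \<Rightarrow> bool" where
  "subquotient H G \<longleftrightarrow>
     (\<exists>S (K :: 'h monoid) f. subgroup S G \<and> group K \<and> f \<in> hom (G\<lparr>carrier := S\<rparr>) K \<and>
        H \<cong> K\<lparr>carrier := f ` S\<rparr>)"

text \<open>
  The (external) semidirect product of the normal factor \<open>N\<close> with \<open>Q\<close>, where \<open>Q\<close> acts on \<open>N\<close>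
  via \<open>\<phi> \<in> hom Q (AutoGroup N)\<close>.
\<close>

definition semidirect_product ::
  "('n, 'k) monoid_scheme \<Rightarrow> ('q, 'l) monoid_scheme \<Rightarrow> ('q \<Rightarrow> 'n \<Rightarrow> 'n) \<Rightarrow> ('n \<times> 'q) monoid" where
  "semidirect_product N Q \<phi> =
     \<lparr>carrier = carrier N \<times> carrier Q,
      monoid.mult = (\<lambda>(x, a) (y, b). (x \<otimes>\<^bsub>N\<^esub> \<phi> a y, a \<otimes>\<^bsub>Q\<^esub> b)),
      one = (\<one>\<^bsub>N\<^esub>, \<one>\<^bsub>Q\<^esub>)\<rparr>"

text \<open>
  A formula cannot quantify over types, so the quantifiers over finite groups range over the groups
  whose elements are natural numbers. Every finite group is isomorphic to one of these
  (\<open>finite_group_iso_nat\<close>), and the defining property then holds for finite groups over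
  arbitrary types (\<open>rhodes_primeD\<close>).
\<close>

definition rhodes_prime :: "('a, 'm) monoid_scheme \<Rightarrow> bool" where
  "rhodes_prime G \<longleftrightarrow> finite_group G \<and> nontrivial G \<and>
     (\<forall>(K :: nat monoid) (G\<^sub>0 :: nat monoid) (G\<^sub>1 :: nat monoid) \<phi>.
        finite_group K \<and> finite_group G\<^sub>0 \<and> finite_group G\<^sub>1 \<and> \<phi> \<in> hom G\<^sub>1 (AutoGroup G\<^sub>0) \<and>
        K \<cong> semidirect_product G\<^sub>0 G\<^sub>1 \<phi> \<and> subquotient G K
        \<longrightarrow> subquotient G G\<^sub>0 \<or> subquotient G G\<^sub>1)"


lemma action_closed:
  assumes "\<phi> \<in> hom Q (AutoGroup N)" "a \<in> carrier Q" "x \<in> carrier N"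
  shows "\<phi> a x \<in> carrier N"
  using assms by (auto simp: hom_def AutoGroup_def auto_def Pi_iff)

lemma action_hom:
  assumes "\<phi> \<in> hom Q (AutoGroup N)" "a \<in> carrier Q"
  shows "\<phi> a \<in> hom N N"
  using assms by (auto simp: hom_def AutoGroup_def auto_def Pi_iff)

lemma action_Bij:
  assumes "\<phi> \<in> hom Q (AutoGroup N)" "a \<in> carrier Q"
  shows "\<phi> a \<in> Bij (carrier N)"
  using assms by (auto simp: hom_def AutoGroup_def auto_def Pi_iff)

lemma action_mult:
  assumes "\<phi> \<in> hom Q (AutoGroup N)" "a \<in> carrier Q" "b \<in> carrier Q" "x \<in> carrier N"
  shows "\<phi> (a \<otimes>\<^bsub>Q\<^esub> b) x = \<phi> a (\<phi> b x)"
proof -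
  have "\<phi> (a \<otimes>\<^bsub>Q\<^esub> b) = \<phi> a \<otimes>\<^bsub>AutoGroup N\<^esub> \<phi> b"
    using assms by (simp add: hom_def)
  then show ?thesis
    using assms action_Bij[OF assms(1)] by (simp add: AutoGroup_def BijGroup_def compose_def)
qed

lemma action_one:
  assumes "group N" "group Q" "\<phi> \<in> hom Q (AutoGroup N)" "x \<in> carrier N"
  shows "\<phi> \<one>\<^bsub>Q\<^esub> x = x"
proof -
  have "\<phi> \<one>\<^bsub>Q\<^esub> = \<one>\<^bsub>AutoGroup N\<^esub>"
    using hom_one[OF assms(3) assms(2) group.AutoGroup[OF assms(1)]] .
  then show ?thesis
    using assms(4) by (simp add: AutoGroup_def BijGroup_def)
qed

lemma semidirect_product_group:
  assumes N: "group N" and Q: "group Q" and \<phi>: "\<phi> \<in> hom Q (AutoGroup N)"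
  shows "group (semidirect_product N Q \<phi>)"
proof -
  interpret N: group N by fact
  interpret Q: group Q by fact
  note cl = action_closed[OF \<phi>]
  have mult: "\<phi> a (x \<otimes>\<^bsub>N\<^esub> y) = \<phi> a x \<otimes>\<^bsub>N\<^esub> \<phi> a y"
    if "a \<in> carrier Q" "x \<in> carrier N" "y \<in> carrier N" for a x y
    using action_hom[OF \<phi> that(1)] that by (simp add: hom_def)
  show ?thesis
  proof (rule groupI)
    fix p assume "p \<in> carrier (semidirect_product N Q \<phi>)"
    then obtain x a where p: "p = (x, a)" "x \<in> carrier N" "a \<in> carrier Q"
      by (auto simp: semidirect_product_def)
    have "\<phi> (inv\<^bsub>Q\<^esub> a) (inv\<^bsub>N\<^esub> x) \<otimes>\<^bsub>N\<^esub> \<phi> (inv\<^bsub>Q\<^esub> a) x = \<phi> (inv\<^bsub>Q\<^esub> a) (inv\<^bsub>N\<^esub> x \<otimes>\<^bsub>N\<^esub> x)"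
      using p mult [of "inv\<^bsub>Q\<^esub> a" "inv\<^bsub>N\<^esub> x" x] by simp
    also have "\<dots> = \<one>\<^bsub>N\<^esub>"
      using p hom_one[OF action_hom[OF \<phi>] N N] by simp
    finally show "\<exists>q\<in>carrier (semidirect_product N Q \<phi>).
        q \<otimes>\<^bsub>semidirect_product N Q \<phi>\<^esub> p = \<one>\<^bsub>semidirect_product N Q \<phi>\<^esub>"
      using p by (intro bexI[of _ "(\<phi> (inv\<^bsub>Q\<^esub> a) (inv\<^bsub>N\<^esub> x), inv\<^bsub>Q\<^esub> a)"])
        (auto simp: semidirect_product_def cl)
  qed (auto simp: semidirect_product_def cl mult action_mult[OF \<phi>] action_one[OF N Q \<phi>]
        N.m_assoc Q.m_assoc)
qed

lemma finite_group_iso_nat: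
  fixes H :: "('h, 'm) monoid_scheme"
  assumes "finite_group H"
  shows "\<exists>K :: nat monoid. finite_group K \<and> H \<cong> K"
proof -
  interpret H: group H using assms by (simp add: finite_group_def)
  obtain f :: "'h \<Rightarrow> nat" where f: "inj_on f (carrier H)"
    using assms finite_imp_inj_to_nat_seg unfolding finite_group_def by metis
  define g where "g = inv_into (carrier H) f"
  have gf: "g (f x) = x" if "x \<in> carrier H" for x
    using f that by (simp add: g_def)
  define K where "K = \<lparr>carrier = f ` carrier H, monoid.mult = (\<lambda>x y. f (g x \<otimes>\<^bsub>H\<^esub> g y)), one = f \<one>\<^bsub>H\<^esub>\<rparr>"
  have "f \<in> iso H K"
    using f by (auto simp: iso_def hom_def bij_betw_def K_def gf)
  moreover from this have "group K"
    using H.iso_imp_img_group[of f K] by (simp add: K_def)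
  ultimately show ?thesis
    using assms by (auto simp: is_iso_def finite_group_def K_def)
qed

lemma epi_of_iso_image:
  assumes "group H" "f \<in> hom (G\<lparr>carrier := S\<rparr>) K" "H \<cong> K\<lparr>carrier := f ` S\<rparr>"
  shows "\<exists>g. g \<in> epi (G\<lparr>carrier := S\<rparr>) H"
proof -
  obtain h where h: "h \<in> iso (K\<lparr>carrier := f ` S\<rparr>) H"
    using group.iso_sym[OF assms(1,3)] by (auto simp: is_iso_def)
  have "f \<in> hom (G\<lparr>carrier := S\<rparr>) (K\<lparr>carrier := f ` S\<rparr>)"
    using assms(2) by (auto simp: hom_def)
  then have "h \<circ> f \<in> hom (G\<lparr>carrier := S\<rparr>) H"
    using h by (auto intro: Group.hom_compose iso_imp_homomorphism)
  moreover have "(h \<circ> f) ` S = carrier H"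
    using h unfolding image_comp [symmetric] by (simp add: iso_iff)
  ultimately show ?thesis by (intro exI[of _ "h \<circ> f"]) (simp add: epi_def)
qed

lemma subquotient_iff_epi:
  assumes "group H"
  shows "subquotient H G \<longleftrightarrow> (\<exists>S f. subgroup S G \<and> f \<in> epi (G\<lparr>carrier := S\<rparr>) H)"
proof
  assume "subquotient H G"
  then show "\<exists>S f. subgroup S G \<and> f \<in> epi (G\<lparr>carrier := S\<rparr>) H"
    unfolding subquotient_def using epi_of_iso_image[OF assms] by blast
next
  assume "\<exists>S f. subgroup S G \<and> f \<in> epi (G\<lparr>carrier := S\<rparr>) H"
  then obtain S f where *: "subgroup S G" "f \<in> epi (G\<lparr>carrier := S\<rparr>) H" by blast
  interpret H: group H by fact
  define K where "K = \<lparr>carrier = carrier H, monoid.mult = (\<otimes>\<^bsub>H\<^esub>), one = \<one>\<^bsub>H\<^esub>\<rparr>"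
  have K: "group K"
    by (rule groupI) (auto simp: K_def H.m_assoc intro: H.l_inv_ex)
  have "f \<in> hom (G\<lparr>carrier := S\<rparr>) K" "f ` S = carrier H"
    using *(2) by (auto simp: epi_def hom_def K_def)
  moreover have "(\<lambda>x. x) \<in> iso H (K\<lparr>carrier := carrier H\<rparr>)"
    by (auto simp: iso_iff hom_def K_def)
  ultimately show "subquotient H G"
    unfolding subquotient_def is_iso_def using *(1) K by (intro exI[of _ S] exI[of _ K] exI[of _ f]) auto
qed

lemma subquotientI:
  fixes K :: "('k, 'l) monoid_scheme"
  assumes "group H" "subgroup S G" "group K" "f \<in> hom (G\<lparr>carrier := S\<rparr>) K"
    and "H \<cong> K\<lparr>carrier := f ` S\<rparr>"
  shows "subquotient H G"
  using assms(2) epi_of_iso_image[OF assms(1,4,5)] by (auto simp: subquotient_iff_epi[OF assms(1)])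

lemma subquotient_iso:
  assumes "group H" "group G" "group G'" "G \<cong> G'" "subquotient H G"
  shows "subquotient H G'"
proof -
  obtain S f where S: "subgroup S G" "f \<in> epi (G\<lparr>carrier := S\<rparr>) H"
    using assms(1,5) subquotient_iff_epi by blast
  obtain i where i: "i \<in> iso G G'"
    using assms(4) by (auto simp: is_iso_def)
  then have i_hom: "i \<in> hom G G'" and inj: "inj_on i (carrier G)"
    by (auto simp: iso_iff)
  have SG: "S \<subseteq> carrier G"
    using S(1) by (rule subgroup.subset)
  interpret i: group_hom G G' i
    using assms(2,3) i_hom by (simp add: group_hom_def group_hom_axioms_def)
  have S': "subgroup (i ` S) G'"
    using S(1) by (rule i.subgroup_img_is_subgroup)
  interpret GS: group "G\<lparr>carrier := S\<rparr>"
    using assms(2) S(1) by (simp add: group.subgroup_imp_group)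
  have "i \<in> iso (G\<lparr>carrier := S\<rparr>) (G'\<lparr>carrier := i ` S\<rparr>)"
    using i_hom inj SG by (auto simp: iso_iff hom_def inj_on_subset subset_iff)
  then have "inv_into S i \<in> iso (G'\<lparr>carrier := i ` S\<rparr>) (G\<lparr>carrier := S\<rparr>)"
    using GS.iso_set_sym by fastforce
  then have e: "inv_into S i \<in> hom (G'\<lparr>carrier := i ` S\<rparr>) (G\<lparr>carrier := S\<rparr>)"
      "inv_into S i ` i ` S = S"
    by (auto simp: iso_iff)
  have "f \<circ> inv_into S i \<in> hom (G'\<lparr>carrier := i ` S\<rparr>) H"
    using e(1) S(2) by (auto simp: epi_def intro: Group.hom_compose)
  moreover have "(f \<circ> inv_into S i) ` i ` S = carrier H"
    using e(2) S(2) unfolding image_comp [symmetric] by (simp add: epi_def)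
  ultimately have "f \<circ> inv_into S i \<in> epi (G'\<lparr>carrier := i ` S\<rparr>) H"
    by (simp add: epi_def)
  then show ?thesis
    using S' assms(1) subquotient_iff_epi by blast
qed

lemma rhodes_primeD:
  fixes K :: "('k, 'x) monoid_scheme" and N :: "('n, 'y) monoid_scheme"
    and Q :: "('q, 'z) monoid_scheme"
  assumes G: "rhodes_prime G"
    and K: "finite_group K" and N: "finite_group N" and Q: "finite_group Q"
    and \<phi>: "\<phi> \<in> hom Q (AutoGroup N)" and iso: "K \<cong> semidirect_product N Q \<phi>"
    and sub: "subquotient G K"
  shows "subquotient G N \<or> subquotient G Q"
proof -
  have gr: "group G" "group K" "group N" "group Q"
    using assms by (auto simp: rhodes_prime_def finite_group_def)
  obtain K' :: "nat monoid" where K': "finite_group K'" "K \<cong> K'"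
    using finite_group_iso_nat[OF K] by blast
  obtain N' :: "nat monoid" and i where N': "finite_group N'" "i \<in> iso N N'"
    using finite_group_iso_nat[OF N] by (auto simp: is_iso_def)
  obtain Q' :: "nat monoid" and j where Q': "finite_group Q'" "j \<in> iso Q Q'"
    using finite_group_iso_nat[OF Q] by (auto simp: is_iso_def)
  have gr': "group K'" "group N'" "group Q'"
    using K' N' Q' by (auto simp: finite_group_def)
  interpret N: group N by fact
  interpret Q: group Q by fact
  define i' where "i' = inv_into (carrier N) i"
  define j' where "j' = inv_into (carrier Q) j"
  have i': "i' \<in> iso N' N" and j': "j' \<in> iso Q' Q"
    unfolding i'_def j'_def using N'(2) Q'(2) N.iso_set_sym Q.iso_set_sym by blast+
  have i_cl: "i x \<in> carrier N'" and i'i: "i' (i x) = x" if "x \<in> carrier N" for x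
    using that N'(2) by (auto simp: iso_iff i'_def)
  have i'_cl: "i' x \<in> carrier N" and ii': "i (i' x) = x" if "x \<in> carrier N'" for x
    using that N'(2) i' by (auto simp: iso_iff i'_def f_inv_into_f)
  have j_cl: "j x \<in> carrier Q'" and j'j: "j' (j x) = x" if "x \<in> carrier Q" for x
    using that Q'(2) by (auto simp: iso_iff j'_def)
  have j'_cl: "j' x \<in> carrier Q" if "x \<in> carrier Q'" for x
    using that j' by (auto simp: iso_iff)
  have i_mult: "i (x \<otimes>\<^bsub>N\<^esub> y) = i x \<otimes>\<^bsub>N'\<^esub> i y" if "x \<in> carrier N" "y \<in> carrier N" for x y
    using that N'(2) by (simp add: iso_def hom_def)
  have j_mult: "j (x \<otimes>\<^bsub>Q\<^esub> y) = j x \<otimes>\<^bsub>Q'\<^esub> j y" if "x \<in> carrier Q" "y \<in> carrier Q" for x y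
    using that Q'(2) by (simp add: iso_def hom_def)
  have j'_mult: "j' (x \<otimes>\<^bsub>Q'\<^esub> y) = j' x \<otimes>\<^bsub>Q\<^esub> j' y" if "x \<in> carrier Q'" "y \<in> carrier Q'" for x y
    using that j' by (simp add: iso_def hom_def)
  define \<psi> where "\<psi> = (\<lambda>a. \<lambda>x\<in>carrier N'. i (\<phi> (j' a) (i' x)))"
  have \<psi>_auto: "\<psi> a \<in> auto N'" if a: "a \<in> carrier Q'" for a
  proof -
    have b: "bij_betw (\<phi> (j' a)) (carrier N) (carrier N)" and h: "\<phi> (j' a) \<in> iso N N"
      using action_Bij[OF \<phi> j'_cl[OF a]] action_hom[OF \<phi> j'_cl[OF a]] by (auto simp: Bij_def iso_def)
    have "i \<circ> (\<phi> (j' a) \<circ> i') \<in> iso N' N'"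
      using iso_set_trans[OF iso_set_trans[OF i' h] N'(2)] .
    then have "\<psi> a \<in> iso N' N'"
      by (rule group.iso_eq[OF gr'(2)]) (simp add: \<psi>_def)
    then show ?thesis
      by (auto simp: auto_def Bij_def iso_def \<psi>_def)
  qed
  have \<psi>: "\<psi> \<in> hom Q' (AutoGroup N')"
  proof (rule homI)
    fix a assume "a \<in> carrier Q'"
    then show "\<psi> a \<in> carrier (AutoGroup N')"
      using \<psi>_auto by (simp add: AutoGroup_def)
  next
    fix a b assume ab: "a \<in> carrier Q'" "b \<in> carrier Q'"
    have "\<psi> (a \<otimes>\<^bsub>Q'\<^esub> b) = compose (carrier N') (\<psi> a) (\<psi> b)"
      using ab by (auto simp: \<psi>_def compose_def j'_mult action_mult[OF \<phi>] j'_cl i'_cl i_cl i'i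
          action_closed[OF \<phi>])
    then show "\<psi> (a \<otimes>\<^bsub>Q'\<^esub> b) = \<psi> a \<otimes>\<^bsub>AutoGroup N'\<^esub> \<psi> b"
      using \<psi>_auto ab by (simp add: AutoGroup_def BijGroup_def auto_def)
  qed
  have "map_prod i j \<in> iso (semidirect_product N Q \<phi>) (semidirect_product N' Q' \<psi>)"
  proof (rule isoI)
    show "map_prod i j \<in> hom (semidirect_product N Q \<phi>) (semidirect_product N' Q' \<psi>)"
      by (rule homI) (auto simp: semidirect_product_def \<psi>_def i_cl j_cl i'i j'j i_mult j_mult
          action_closed[OF \<phi>])
    show "bij_betw (map_prod i j) (carrier (semidirect_product N Q \<phi>))
        (carrier (semidirect_product N' Q' \<psi>))"
      using N'(2) Q'(2) by (auto simp: iso_def semidirect_product_def intro: bij_betw_map_prod)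
  qed
  then have "semidirect_product N Q \<phi> \<cong> semidirect_product N' Q' \<psi>"
    by (rule is_isoI)
  then have "K' \<cong> semidirect_product N' Q' \<psi>"
    using iso_trans[OF iso_trans[OF group.iso_sym[OF gr(2) K'(2)] iso]] by blast
  moreover have "subquotient G K'"
    using subquotient_iso[OF gr(1,2) gr'(1) K'(2) sub] .
  ultimately have "subquotient G N' \<or> subquotient G Q'"
    using G K'(1) N'(1) Q'(1) \<psi> unfolding rhodes_prime_def by blast
  moreover have "N' \<cong> N" "Q' \<cong> Q"
    using i' j' by (auto simp: is_iso_def)
  ultimately show ?thesis
    using subquotient_iso[OF gr(1) gr'(2) gr(3)] subquotient_iso[OF gr(1) gr'(3) gr(4)] by blast
qed

end

theory Submission
  imports Defs "HOL-Algebra.Product_Groups"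
begin

text \<open>
  Suppose that \<open>N\<close> is a normal subgroup of \<open>G\<close> other than \<open>{\<one>}\<close> and \<open>G\<close>, and let
  \<open>Q = G / N\<close>. The theorem of Kaloujnine and Krasner embeds \<open>G\<close> into the wreath product
  \<open>N\<^sup>Q \<rtimes> Q\<close>, a finite semidirect product whose normal factor is the group of all functions from
  \<open>Q\<close> to \<open>N\<close> (\<open>wreath_embedding\<close>). A Rhodes-prime \<open>G\<close> is therefore a subquotient of \<open>Q\<close> or of
  \<open>N\<^sup>Q\<close>.

  The power \<open>N\<^sup>Q\<close> may have a subquotient larger than \<open>N\<close>, so in the second case primeness
  has to be used again: a direct product is a semidirect product with trivial action, and splitting
  off one factor of \<open>N\<^sup>Q\<close> after the other shows that \<open>G\<close> is a subquotient of \<open>N\<close> itself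
  (\<open>rhodes_prime_product_group\<close>). But \<open>N\<close> and \<open>Q\<close> both have fewer elements than \<open>G\<close>, and a
  subquotient of a finite group is no larger than that group.
\<close>

section \<open>Sizes of subquotients\<close>

lemma subquotient_order_le:
  assumes "group H" "finite (carrier G)" "subquotient H G"
  shows "order H \<le> order G"
proof -
  obtain S f where S: "subgroup S G" and f: "f \<in> epi (G\<lparr>carrier := S\<rparr>) H"
    using assms(1,3) subquotient_iff_epi by blast
  have SG: "S \<subseteq> carrier G"
    using S by (rule subgroup.subset)
  have "card (carrier H) = card (f ` S)"
    using f by (simp add: epi_def)
  also have "\<dots> \<le> card S"
    using SG assms(2) by (intro card_image_le) (rule finite_subset)
  also have "\<dots> \<le> card (carrier G)"
    using SG assms(2) by (rule card_mono[rotated])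
  finally show ?thesis
    by (simp add: order_def)
qed

lemma nontrivial_order:
  assumes "finite_group G" "nontrivial G"
  shows "order G > 1"
proof -
  obtain x y where "{x, y} \<subseteq> carrier G" "x \<noteq> y"
    using assms(2) by (auto simp: nontrivial_def)
  then show ?thesis
    using assms(1) card_mono[of "carrier G" "{x, y}"] by (simp add: order_def finite_group_def)
qed

lemma subquotient_of_embedding:
  assumes "group G" "group K" "e \<in> hom G K" "inj_on e (carrier G)"
  shows "subquotient G K"
proof -
  interpret e: group_hom G K e
    using assms by (simp add: group_hom_def group_hom_axioms_def)
  have "e \<in> iso G (K\<lparr>carrier := e ` carrier G\<rparr>)"
    using assms(3,4) by (auto simp: iso_iff hom_def)
  then have "inv_into (carrier G) e \<in> iso (K\<lparr>carrier := e ` carrier G\<rparr>) G"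
    by (rule group.iso_set_sym[OF assms(1)])
  then have "inv_into (carrier G) e \<in> epi (K\<lparr>carrier := e ` carrier G\<rparr>) G"
    by (auto simp: iso_iff epi_def)
  then show ?thesis
    using e.img_is_subgroup assms(1) subquotient_iff_epi by blast
qed

section \<open>Direct products\<close>

lemma trivial_action:
  assumes "group N" "group Q"
  shows "(\<lambda>_. \<lambda>x\<in>carrier N. x) \<in> hom Q (AutoGroup N)"
proof -
  interpret A: group "AutoGroup N"
    using assms(1) by (rule group.AutoGroup)
  have "\<one>\<^bsub>AutoGroup N\<^esub> = (\<lambda>x\<in>carrier N. x)"
    by (simp add: AutoGroup_def BijGroup_def)
  then show ?thesis
    using A.one_closed A.l_one[OF A.one_closed] by (auto simp: hom_def)
qed

text \<open>
  A direct product is a semidirect product with trivial action. Splitting off a single factor in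
  this form lets an induction over the index set appeal to primeness at each step.
\<close>

lemma product_group_insert_iso:
  assumes "i \<notin> J" "\<And>j. j \<in> insert i J \<Longrightarrow> group (A j)"
  shows "product_group (insert i J) A \<cong>
    semidirect_product (A i) (product_group J A) (\<lambda>_. \<lambda>x\<in>carrier (A i). x)"
    (is "?P \<cong> ?S")
proof (rule is_isoI, rule isoI)
  let ?f = "\<lambda>x. (x i, restrict x J)"
  show "?f \<in> hom ?P ?S"
    using assms(1) by (intro homI) (auto simp: semidirect_product_def)
  show "bij_betw ?f (carrier ?P) (carrier ?S)"
    by (rule bij_betw_byWitness[where f' = "\<lambda>(a, y). y(i := a)"])
      (use assms(1) in \<open>auto simp: semidirect_product_def PiE_iff extensional_def fun_eq_iff split: if_splits\<close>)
qed

lemma finite_group_product_group: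
  assumes "finite I" "\<And>i. i \<in> I \<Longrightarrow> finite_group (A i)"
  shows "finite_group (product_group I A)"
  using assms by (auto simp: finite_group_def intro: finite_PiE)

text \<open>
  Primeness speaks of two factors; this extends it to finite direct products. The empty product
  does not occur because it is too small to have the nontrivial group \<open>G\<close> as a subquotient.
\<close>

lemma rhodes_prime_product_group:
  assumes G: "rhodes_prime G" and "finite I" and "\<And>i. i \<in> I \<Longrightarrow> finite_group (A i)"
    and "subquotient G (product_group I A)"
  shows "\<exists>i\<in>I. subquotient G (A i)"
  using assms(2-)
proof (induction I rule: finite_induct)
  case empty
  have "order G > 1" "group G"
    using G nontrivial_order by (auto simp: rhodes_prime_def finite_group_def)
  then show ?case
    using subquotient_order_le[of G "product_group {} A"] empty by (simp add: order_def)
next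
  case (insert i J)
  have fin: "finite_group (A i)" "finite_group (product_group J A)"
      "finite_group (product_group (insert i J) A)"
    using insert.hyps insert.prems(1) by (auto intro: finite_group_product_group)
  then have "subquotient G (A i) \<or> subquotient G (product_group J A)"
    using insert.hyps(2) insert.prems
    by (intro rhodes_primeD[OF G fin(3,1,2) trivial_action product_group_insert_iso])
      (auto simp: finite_group_def)
  then show ?case
    using insert by auto
qed

section \<open>The wreath product embedding\<close>

text \<open>
  The action of the regular wreath product of \<open>N\<close> by \<open>Q\<close>: the group \<open>Q\<close> translates the arguments of the
  functions from \<open>Q\<close> to \<open>N\<close>. The inverse makes this a left action.
\<close>

definition translation_action ::
  "('n, 'k) monoid_scheme \<Rightarrow> ('q, 'l) monoid_scheme \<Rightarrow> 'q \<Rightarrow> ('q \<Rightarrow> 'n) \<Rightarrow> ('q \<Rightarrow> 'n)" where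
  "translation_action N Q a =
     (\<lambda>f\<in>carrier Q \<rightarrow>\<^sub>E carrier N. \<lambda>q\<in>carrier Q. f (inv\<^bsub>Q\<^esub> a \<otimes>\<^bsub>Q\<^esub> q))"

lemma translation_action_hom:
  assumes N: "group N" and Q: "group Q"
  shows "translation_action N Q \<in> hom Q (AutoGroup (product_group (carrier Q) (\<lambda>_. N)))"
    (is "?\<phi> \<in> hom Q (AutoGroup ?P)")
proof -
  interpret N: group N by fact
  interpret Q: group Q by fact
  have cl: "?\<phi> a f \<in> carrier Q \<rightarrow>\<^sub>E carrier N" if "a \<in> carrier Q" "f \<in> carrier Q \<rightarrow>\<^sub>E carrier N" for a f
    using that by (auto simp: translation_action_def PiE_iff)
  have comp: "?\<phi> (a \<otimes>\<^bsub>Q\<^esub> b) f = ?\<phi> a (?\<phi> b f)"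
    if "a \<in> carrier Q" "b \<in> carrier Q" "f \<in> carrier Q \<rightarrow>\<^sub>E carrier N" for a b f
    using that cl[of b f]
    by (auto simp: translation_action_def Q.inv_mult_group Q.m_assoc)
  have one: "?\<phi> \<one>\<^bsub>Q\<^esub> f = f" if "f \<in> carrier Q \<rightarrow>\<^sub>E carrier N" for f
    using that by (auto simp: translation_action_def fun_eq_iff PiE_iff extensional_def)
  have inverse: "?\<phi> (inv\<^bsub>Q\<^esub> a) (?\<phi> a f) = f" "?\<phi> a (?\<phi> (inv\<^bsub>Q\<^esub> a) f) = f"
    if "a \<in> carrier Q" "f \<in> carrier Q \<rightarrow>\<^sub>E carrier N" for a f
    using that comp[of "inv\<^bsub>Q\<^esub> a" a f] comp[of a "inv\<^bsub>Q\<^esub> a" f] one by auto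
  have aut: "?\<phi> a \<in> auto ?P" if a: "a \<in> carrier Q" for a
  proof -
    have "?\<phi> a \<in> hom ?P ?P"
      using a cl by (intro homI) (auto simp: translation_action_def PiE_iff)
    moreover have "bij_betw (?\<phi> a) (carrier Q \<rightarrow>\<^sub>E carrier N) (carrier Q \<rightarrow>\<^sub>E carrier N)"
      using a cl inverse by (intro bij_betw_byWitness[where f' = "?\<phi> (inv\<^bsub>Q\<^esub> a)"]) auto
    ultimately show ?thesis
      by (simp add: auto_def Bij_def translation_action_def)
  qed
  show ?thesis
  proof (rule homI)
    fix a b assume ab: "a \<in> carrier Q" "b \<in> carrier Q"
    have "?\<phi> (a \<otimes>\<^bsub>Q\<^esub> b) = compose (carrier ?P) (?\<phi> a) (?\<phi> b)"
    proof
      fix f show "?\<phi> (a \<otimes>\<^bsub>Q\<^esub> b) f = compose (carrier ?P) (?\<phi> a) (?\<phi> b) f"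
        using ab comp by (cases "f \<in> carrier ?P") (auto simp: compose_def translation_action_def)
    qed
    then show "?\<phi> (a \<otimes>\<^bsub>Q\<^esub> b) = ?\<phi> a \<otimes>\<^bsub>AutoGroup ?P\<^esub> ?\<phi> b"
      using aut ab by (simp add: AutoGroup_def BijGroup_def auto_def)
  qed (simp add: aut AutoGroup_def)
qed

text \<open>
  The theorem of Kaloujnine and Krasner for an epimorphism \<open>\<pi>\<close> with kernel \<open>N\<close>. Given a section
  \<open>t\<close> of \<open>\<pi>\<close>, an element \<open>g\<close> multiplies \<open>t (\<pi>(g)\<^sup>-\<^sup>1 q)\<close> into the fibre over \<open>q\<close>,
  so \<open>t(q)\<^sup>-\<^sup>1 g t (\<pi>(g)\<^sup>-\<^sup>1 q)\<close> lies in \<open>N\<close>. These corrections form a function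
  \<open>c g\<close> from \<open>Q\<close> to \<open>N\<close>, and \<open>g \<mapsto> (c g, \<pi> g)\<close> is the embedding. It is multiplicative because
  in the product of the corrections for \<open>g\<close> and \<open>h\<close> the inner values of \<open>t\<close> cancel; it is
  injective because \<open>t(q)\<close>, \<open>c g q\<close> and \<open>\<pi> g\<close> determine \<open>g\<close>.
\<close>

lemma wreath_embedding:
  assumes \<pi>: "group_hom G Q \<pi>" and surj: "\<pi> ` carrier G = carrier Q"
    and N: "N = G\<lparr>carrier := kernel G Q \<pi>\<rparr>"
  shows "\<exists>e \<in> hom G (semidirect_product (product_group (carrier Q) (\<lambda>_. N)) Q (translation_action N Q)).
    inj_on e (carrier G)"
    (is "\<exists>e \<in> hom G ?W. _")
proof -
  interpret \<pi>: group_hom G Q \<pi> by fact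
  define t where "t = inv_into (carrier G) \<pi>"
  have t: "t q \<in> carrier G" "\<pi> (t q) = q" if "q \<in> carrier Q" for q
    using that surj by (auto simp: t_def inv_into_into f_inv_into_f)
  define c where "c g = (\<lambda>q\<in>carrier Q. inv\<^bsub>G\<^esub> t q \<otimes>\<^bsub>G\<^esub> g \<otimes>\<^bsub>G\<^esub> t (inv\<^bsub>Q\<^esub> \<pi> g \<otimes>\<^bsub>Q\<^esub> q))" for g
  have Q_cancel: "a \<otimes>\<^bsub>Q\<^esub> (inv\<^bsub>Q\<^esub> a \<otimes>\<^bsub>Q\<^esub> q) = q" if "a \<in> carrier Q" "q \<in> carrier Q" for a q
    using that by (simp flip: \<pi>.H.m_assoc)
  have c_ker: "c g \<in> carrier Q \<rightarrow>\<^sub>E carrier N" if "g \<in> carrier G" for g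
    using that t by (auto simp: c_def N kernel_def \<pi>.H.m_assoc Q_cancel)
  \<comment> \<open>Here \<open>u\<close>, \<open>v\<close>, \<open>w\<close> stand for values of \<open>t\<close> or inverses of these.\<close>
  have cancel: "(u \<otimes>\<^bsub>G\<^esub> g \<otimes>\<^bsub>G\<^esub> v) \<otimes>\<^bsub>G\<^esub> (inv\<^bsub>G\<^esub> v \<otimes>\<^bsub>G\<^esub> h \<otimes>\<^bsub>G\<^esub> w) = u \<otimes>\<^bsub>G\<^esub> (g \<otimes>\<^bsub>G\<^esub> h) \<otimes>\<^bsub>G\<^esub> w"
    if "u \<in> carrier G" "g \<in> carrier G" "v \<in> carrier G" "h \<in> carrier G" "w \<in> carrier G" for u g v h w
    using that by (simp add: \<pi>.G.m_assoc flip: \<pi>.G.m_assoc[of v "inv\<^bsub>G\<^esub> v"])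
  have c_mult: "c (g \<otimes>\<^bsub>G\<^esub> h) = c g \<otimes>\<^bsub>product_group (carrier Q) (\<lambda>_. N)\<^esub> translation_action N Q (\<pi> g) (c h)"
    if g: "g \<in> carrier G" and h: "h \<in> carrier G" for g h
  proof -
    have "c (g \<otimes>\<^bsub>G\<^esub> h) q = c g q \<otimes>\<^bsub>G\<^esub> translation_action N Q (\<pi> g) (c h) q"
      if q: "q \<in> carrier Q" for q
      using g h q t c_ker[OF h]
      by (simp add: c_def translation_action_def cancel \<pi>.H.inv_mult_group \<pi>.H.m_assoc)
    then show ?thesis
      by (auto simp: N c_def fun_eq_iff)
  qed
  let ?e = "\<lambda>g. (c g, \<pi> g)"
  have "?e \<in> hom G ?W"
    using c_ker c_mult by (intro homI) (auto simp: semidirect_product_def)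
  moreover have "inj_on ?e (carrier G)"
  proof (rule inj_onI)
    fix g h assume gh: "g \<in> carrier G" "h \<in> carrier G" "?e g = ?e h"
    then have "c g \<one>\<^bsub>Q\<^esub> = c h \<one>\<^bsub>Q\<^esub>" "\<pi> g = \<pi> h"
      by auto
    then show "g = h"
      using gh t by (simp add: c_def)
  qed
  ultimately show ?thesis by blast
qed

section \<open>Rhodes-prime groups are simple\<close>

text \<open>
  Primeness by itself speaks of split extensions only. Every extension of \<open>Q\<close> by \<open>N\<close> embeds into
  the split extension \<open>N\<^sup>Q \<rtimes> Q\<close>, and passing from \<open>N\<close> to \<open>N\<^sup>Q\<close> does no harm since primeness
  leads back from a power to its factor.
\<close>

lemma rhodes_prime_epi:
  assumes G: "rhodes_prime G" and \<pi>: "\<pi> \<in> epi G Q" and Q: "group Q"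
  shows "subquotient G (G\<lparr>carrier := kernel G Q \<pi>\<rparr>) \<or> subquotient G Q"
proof -
  have fin: "finite (carrier G)" and gr: "group G"
    using G by (auto simp: rhodes_prime_def finite_group_def)
  interpret \<pi>: group_hom G Q \<pi>
    using \<pi> Q gr by (simp add: group_hom_def group_hom_axioms_def epi_def)
  define N where "N = G\<lparr>carrier := kernel G Q \<pi>\<rparr>"
  let ?P = "product_group (carrier Q) (\<lambda>_. N)"
  let ?W = "semidirect_product ?P Q (translation_action N Q)"
  have surj: "\<pi> ` carrier G = carrier Q"
    using \<pi> by (simp add: epi_def)
  have Q_fin: "finite_group Q"
    using Q fin by (simp add: finite_group_def flip: surj)
  have "finite (kernel G Q \<pi>)"
    using fin by (simp add: kernel_def)
  then have N_fin: "finite_group N"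
    using \<pi>.subgroup_kernel gr by (simp add: N_def finite_group_def group.subgroup_imp_group)
  have P_fin: "finite_group ?P"
    using N_fin Q_fin by (intro finite_group_product_group) (auto simp: finite_group_def)
  have act: "translation_action N Q \<in> hom Q (AutoGroup ?P)"
    using N_fin Q by (simp add: translation_action_hom finite_group_def)
  have "finite (carrier ?W)"
    using P_fin Q_fin unfolding semidirect_product_def finite_group_def by simp
  then have W_fin: "finite_group ?W"
    using P_fin Q act by (simp add: semidirect_product_group finite_group_def)
  obtain e where "e \<in> hom G ?W" "inj_on e (carrier G)"
    using wreath_embedding[OF \<pi>.group_hom_axioms surj N_def] by blast
  then have "subquotient G ?W"
    using gr W_fin by (simp add: subquotient_of_embedding finite_group_def)
  then have "subquotient G ?P \<or> subquotient G Q"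
    by (rule rhodes_primeD[OF G W_fin P_fin Q_fin act iso_refl])
  then show ?thesis
    using rhodes_prime_product_group[OF G, of "carrier Q" "\<lambda>_. N"] N_fin Q_fin
    by (auto simp: N_def finite_group_def)
qed

theorem proposition6p5:
  fixes G :: "('a, 'm) monoid_scheme"
  assumes "finite_group G" and "nontrivial G" and "rhodes_prime G"
  shows "simple_group G"
proof -
  interpret G: group G
    using assms(1) by (simp add: finite_group_def)
  have fin: "finite (carrier G)"
    using assms(1) by (simp add: finite_group_def)
  show ?thesis
  proof (unfold_locales)
    show "order G > 1"
      using assms(1,2) by (rule nontrivial_order)
  next
    fix N assume normal: "N \<lhd> G"
    interpret N: normal N G by fact
    let ?\<pi> = "\<lambda>g. N #>\<^bsub>G\<^esub> g"
    have epi: "?\<pi> \<in> epi G (G Mod N)"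
      using N.r_coset_hom_Mod by (auto simp: epi_def FactGroup_def RCOSETS_def)
    have "kernel G (G Mod N) ?\<pi> = N"
      using G.coset_join1[OF _ _ N.subgroup_axioms] G.coset_join2[OF _ N.subgroup_axioms] N.subset
      by (auto simp: kernel_def FactGroup_def)
    then consider "subquotient G (G\<lparr>carrier := N\<rparr>)" | "subquotient G (G Mod N)"
      using rhodes_prime_epi[OF assms(3) epi N.factorgroup_is_group] by auto
    then show "N = carrier G \<or> N = {\<one>\<^bsub>G\<^esub>}"
    proof cases
      case 1
      then have "order G \<le> card N"
        using subquotient_order_le[OF G.is_group _ 1] finite_subset[OF N.subset fin]
        by (simp add: order_def)
      then show ?thesis
        using card_seteq[OF fin N.subset] by (simp add: order_def)
    next
      case 2
      have "finite (carrier (G Mod N))"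
        using fin by (simp add: FactGroup_def RCOSETS_def)
      then have "order G \<le> card (rcosets\<^bsub>G\<^esub> N)"
        using subquotient_order_le[OF G.is_group _ 2] by (simp add: order_def FactGroup_def)
      then have "card (rcosets\<^bsub>G\<^esub> N) * card N \<le> card (rcosets\<^bsub>G\<^esub> N) * 1"
        using G.lagrange[OF N.subgroup_axioms] by simp
      moreover have "card (rcosets\<^bsub>G\<^esub> N) > 0"
        using \<open>order G \<le> card (rcosets\<^bsub>G\<^esub> N)\<close> fin G.order_gt_0_iff_finite by linarith
      ultimately have "card N \<le> 1"
        by (simp only: nat_mult_le_cancel1)
      then have "\<forall>x\<in>N. \<forall>y\<in>N. x = y"
        using card_le_Suc0_iff_eq[OF finite_subset[OF N.subset fin]] by simp
      then show ?thesis
        using N.one_closed by blast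
    qed
  qed
qed

end
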